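(* The equation $$u''+\bigl[u^2+(u+u')^2-1\bigr]u'+u=0$$ has a non-trivial (non-constant) periodic solution, and this periodic solution is unique, in the sense that the planar system $x'=y,\ y'=-\bigl[x^2+(x+y)^2-1\bigr]y-x$ has exactly one non-constant periodic orbit. *)

theory Defs
  imports "HOL-Analysis.Analysis" "HOL-Library.Periodic_Fun"
begin

definition nonconst_periodic :: "(real \<Rightarrow> 'a) \<Rightarrow> bool" where
  "nonconst_periodic f \<longleftrightarrow>
     (\<exists>T>0. periodic_fun_simple f T) \<and> \<not> f constant_on UNIV"

definition solves_ode2 :: "(real \<Rightarrow> real) \<Rightarrow> bool" where
  "solves_ode2 u \<longleftrightarrow>
     (\<forall>t. u differentiable (at t)) \<and>
     (\<forall>t. deriv u differentiable (at t)) \<and>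
     (\<forall>t. deriv (deriv u) t + ((u t)\<^sup>2 + (u t + deriv u t)\<^sup>2 - 1) * deriv u t + u t = 0)"

definition solves_system :: "(real \<Rightarrow> real) \<Rightarrow> (real \<Rightarrow> real) \<Rightarrow> bool" where
  "solves_system x y \<longleftrightarrow>
     (\<forall>t. (x has_real_derivative y t) (at t)) \<and>
     (\<forall>t. (y has_real_derivative
            - ((x t)\<^sup>2 + (x t + y t)\<^sup>2 - 1) * y t - x t) (at t))"

text \<open>Orbits are subsets of the phase plane, so time shifts of a solution give the same orbit.\<close>

definition nonconst_periodic_orbit :: "(real \<times> real) set \<Rightarrow> bool" where
  "nonconst_periodic_orbit \<Gamma> \<longleftrightarrow>
     (\<exists>x y. solves_system x y \<and> nonconst_periodic (\<lambda>t. (x t, y t)) \<and>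
            \<Gamma> = range (\<lambda>t. (x t, y t)))"

end

(* With rho = r^2 = e^u the orbits satisfy du/dtheta = 2 sin^2 theta phi / (1 + sin theta cos theta phi),
   where phi = q(theta) e^u - 1 and q > 0. The slope is increasing in u (phi is strictly
   star-shaped), nonpositive on the circle rho = 1/3 and nonnegative on rho = 8/3, and the angular
   speed is positive in the disc rho <= 8/3. Hence there is a periodic solution u(theta) in the
   annulus. For any other solution, V = ln rho - u(theta) satisfies
   V' = 2 sin^2 theta (phi(u) - phi) / (1 + sin theta cos theta phi(u)), which has the sign of -V,
   so V = 0 along every nonconstant periodic orbit. *)

theory Submission
  imports Defs
begin

text \<open>Existence is obtained from a fixed point in a space of periodic functions instead of a
  return map. The obstacle is the factor sin^2 \<theta>: it vanishes at multiples of pi, so the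
  slope has no uniform growth rate in \<open>u\<close>, and a contraction appears only after
  integrating over a full turn. The outer radius is a compromise. It must be large enough for the
  damping to be nonnegative on the whole circle, yet the angular speed does vanish at points farther
  out. An arbitrary periodic orbit might a priori go there, where it need not be a graph over the
  angle. Uniqueness is therefore argued in time: V' contains in its denominator only the angular
  speed of the known cycle at the same angle, which is bounded below.\<close>

section \<open>Periodic solutions of scalar equations with periodic coefficients\<close>

lemma continuous_imp_antiderivative:
  fixes f :: "real \<Rightarrow> 'a::euclidean_space"
  assumes "continuous_on UNIV f"
  obtains F where "\<And>t. (F has_vector_derivative f t) (at t)"
proof -
  have "isCont f t" for t
    using assms by (simp add: continuous_on_eq_continuous_at)
  then show ?thesis
    using einterval_antiderivative[of "-\<infinity>" "\<infinity>" f] that by auto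
qed

text \<open>The bounded solution is the integral of exp (- L * (s - x)) * h s over all s \<ge> x. As
  h is periodic, the contributions of successive periods form a geometric series; this leaves one
  period and the factor 1 / (1 - exp (- L * P)).\<close>

lemma periodic_solution_linear:
  fixes h :: "real \<Rightarrow> real"
  assumes "L > 0" "P > 0" and cont: "continuous_on UNIV h" and per: "\<And>x. h (x + P) = h x"
  obtains v where "\<And>x. (v has_real_derivative L * v x - h x) (at x)"
    and "\<And>x. v (x + P) = v x"
proof -
  have "continuous_on UNIV (\<lambda>x. exp (- L * x) * h x)"
    by (intro continuous_intros cont)
  from continuous_imp_antiderivative[OF this] obtain B
    where B: "\<And>x. (B has_real_derivative exp (- L * x) * h x) (at x)"
    unfolding has_real_derivative_iff_has_vector_derivative by blast
  note B' = DERIV_chain2[OF B, THEN DERIV_cong]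
  define c where "c = 1 / (1 - exp (- L * P))"
  have c: "c * (1 - exp (- L * P)) = 1"
    using assms by (simp add: c_def)
  define v where "v x = c * exp (L * x) * (B (x + P) - B x)" for x
  have exp_shift: "exp (- L * (x + P)) = exp (- L * P) * exp (- L * x)" for x
    by (simp add: exp_add[symmetric] algebra_simps)
  have exp_cancel: "exp (L * x) * exp (- L * x) = 1" for x
    by (simp add: exp_add[symmetric])
  have 1: "(v has_real_derivative L * v x - h x) (at x)" for x
  proof -
    have "(v has_real_derivative L * v x + c * (exp (L * x) * (exp (- L * (x + P)) * h (x + P))
            - exp (L * x) * (exp (- L * x) * h x))) (at x)"
      unfolding v_def by (auto intro!: derivative_eq_intros B' simp: algebra_simps)
    also have "L * v x + c * (exp (L * x) * (exp (- L * (x + P)) * h (x + P))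
            - exp (L * x) * (exp (- L * x) * h x))
        = L * v x - (c * (1 - exp (- L * P))) * (exp (L * x) * exp (- L * x)) * h x"
      unfolding exp_shift per by (simp only: algebra_simps)
    finally show ?thesis by (simp only: c exp_cancel mult_1)
  qed
  have 2: "v (x + P) = v x" for x
  proof -
    define \<Delta> where "\<Delta> x = B (x + P) - exp (- L * P) * B x" for x
    have "(\<Delta> has_real_derivative exp (- L * (y + P)) * h (y + P) - exp (- L * P) * (exp (- L * y) * h y)) (at y)" for y
      unfolding \<Delta>_def by (auto intro!: derivative_eq_intros B')
    then have "(\<Delta> has_real_derivative 0) (at y)" for y
      by (simp only: exp_shift per mult.assoc diff_self)
    then have "\<Delta> (x + P) = \<Delta> x"
      by (intro DERIV_isconst_all) auto
    then have "B (x + P + P) - B (x + P) = exp (- L * P) * (B (x + P) - B x)"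
      by (simp add: \<Delta>_def algebra_simps)
    then have "v (x + P) = c * (exp (L * (x + P)) * exp (- L * P)) * (B (x + P) - B x)"
      by (simp add: v_def)
    also have "exp (L * (x + P)) * exp (- L * P) = exp (L * x)"
      by (simp add: exp_add[symmetric] algebra_simps)
    finally show ?thesis by (simp add: v_def)
  qed
  show ?thesis using that 1 2 by blast
qed

text \<open>A maximum principle with a gain. The kernel exp (- L * s) / (1 - exp (- L * P)) has mass
  1 / L over one period, so h \<le> L * D alone gives v \<le> D. Subtracting m lowers this by at
  least the smallest kernel value times the mass c of m over a period.\<close>

lemma periodic_solution_linear_le:
  fixes h :: "real \<Rightarrow> real"
  assumes "L > 0" "P > 0"
    and v: "\<And>x. (v has_real_derivative L * v x - h x) (at x)" "\<And>x. v (x + P) = v x"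
    and M: "\<And>x. (M has_real_derivative m x) (at x)" "\<And>x. M (x + P) = M x + c"
    and m: "\<And>x. 0 \<le> m x"
    and h: "\<And>x. h x \<le> L * D - m x"
  shows "v x \<le> D - c * (exp (- L * P) / (1 - exp (- L * P)))"
proof -
  define E where "E = exp (- L * P)"
  have E: "0 < E" "E < 1" using assms by (auto simp: E_def)
  note v' = DERIV_chain2[OF v(1), THEN DERIV_cong]
  note M' = DERIV_chain2[OF M(1), THEN DERIV_cong]
  \<comment> \<open>Its monotonicity is the differential form of the integral estimate;
    \<open>E\<close> is the least value of exp (- L * s) on the period.\<close>
  let ?\<Phi> = "\<lambda>s. exp (- L * s) * (D - v (x + s)) + E * M (x + s)"
  have "?\<Phi> P \<le> ?\<Phi> 0"
  proof (rule DERIV_nonpos_imp_nonincreasing[of 0 P ?\<Phi>])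
    fix s assume s: "0 \<le> s" "s \<le> P"
    have "(?\<Phi> has_real_derivative exp (- L * s) * (h (x + s) - L * D) + E * m (x + s)) (at s)"
      by (auto intro!: derivative_eq_intros v' M' simp: algebra_simps)
    moreover have "exp (- L * s) * (h (x + s) - L * D) \<le> exp (- L * s) * (- m (x + s))"
      by (rule mult_left_mono) (use h[of "x + s"] in auto)
    moreover have "E * m (x + s) \<le> exp (- L * s) * m (x + s)"
      by (rule mult_right_mono) (use m s assms in \<open>auto simp: E_def\<close>)
    ultimately show "\<exists>y. (?\<Phi> has_real_derivative y) (at s) \<and> y \<le> 0"
      by (intro exI[of _ "exp (- L * s) * (h (x + s) - L * D) + E * m (x + s)"]) auto
  qed (use assms in auto)
  then have "E * (D - v x) + E * (M x + c) \<le> D - v x + E * M x"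
    by (simp add: v M E_def)
  then have "E * c \<le> (1 - E) * (D - v x)" by (simp add: algebra_simps)
  then have "E * c / (1 - E) \<le> D - v x"
    using E by (simp add: divide_le_eq mult.commute)
  then show ?thesis unfolding E_def[symmetric] by (simp add: mult.commute)
qed

text \<open>Rewriting \<open>u' = K u\<close> as \<open>u' = L u - (L u - K u)\<close> makes the periodic solution a fixed
  point of a map that is a contraction because \<open>K\<close> grows at least like \<open>m\<close> in \<open>u\<close>.\<close>

lemma periodic_solution:
  fixes K :: "real \<Rightarrow> real \<Rightarrow> real"
  assumes "L > 0" "P > 0" "a \<le> b" "c > 0"
    and cont: "continuous_on (UNIV \<times> {a..b}) (\<lambda>(x, u). K x u)"
    and per: "\<And>x u. K (x + P) u = K x u"
    and Ka: "\<And>x. K x a \<le> 0" and Kb: "\<And>x. 0 \<le> K x b"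
    and M: "\<And>x. (M has_real_derivative m x) (at x)" "\<And>x. M (x + P) = M x + c"
    and m: "\<And>x. 0 \<le> m x"
    and lower: "\<And>x u v. a \<le> u \<Longrightarrow> u \<le> v \<Longrightarrow> v \<le> b \<Longrightarrow> m x * (v - u) \<le> K x v - K x u"
    and upper: "\<And>x u v. a \<le> u \<Longrightarrow> u \<le> v \<Longrightarrow> v \<le> b \<Longrightarrow> K x v - K x u \<le> L * (v - u)"
  obtains u where "\<And>x. (u has_real_derivative K x (u x)) (at x)"
    and "\<And>x. u (x + P) = u x" and "\<And>x. u x \<in> {a..b}"
proof -
  \<comment> \<open>By \<open>upper\<close>, \<open>H\<close> is nondecreasing in u, so the linear
    problem with right-hand side \<open>H\<close> preserves order; \<open>Ka\<close> and
    \<open>Kb\<close> make the constants a and b barriers for it.\<close>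
  define H where "H x u = L * u - K x u" for x u
  have H_mono: "H x u \<le> H x v" if "a \<le> u" "u \<le> v" "v \<le> b" for x u v
    using upper[OF that, of x] by (simp add: H_def algebra_simps)
  have H_contr: "H x v - H x u \<le> (L - m x) * (v - u)" if "a \<le> u" "u \<le> v" "v \<le> b" for x u v
    using lower[OF that, of x] by (simp add: H_def algebra_simps)
  \<comment> \<open>For a = b both growth conditions read 0 \<le> 0 and do not relate m to L; that
    case is split off where it arises.\<close>
  have mL: "m x \<le> L" if "a < b" for x
    using lower[of a b x] upper[of a b x] that by (smt (verit) mult_le_cancel_right)
  define S where "S = {u :: real \<Rightarrow>\<^sub>C real. \<forall>x. apply_bcontfun u x \<in> {a..b} \<and>
      apply_bcontfun u (x + P) = apply_bcontfun u x}"
  define sol where "sol u v \<longleftrightarrow>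
      (\<forall>x. (apply_bcontfun v has_real_derivative L * apply_bcontfun v x - H x (apply_bcontfun u x)) (at x))"
    for u v
  have S_closed: "closed S"
  proof -
    have ev: "continuous_on UNIV (\<lambda>u :: real \<Rightarrow>\<^sub>C real. apply_bcontfun u x)" for x
      unfolding continuous_on_iff using dist_fun_lt_imp_dist_val_lt by blast
    have "S = (\<Inter>x. {u. apply_bcontfun u x \<in> {a..b}} \<inter>
        {u. apply_bcontfun u (x + P) = apply_bcontfun u x})"
      by (auto simp: S_def)
    also have "closed \<dots>"
      unfolding atLeastAtMost_iff
      by (intro closed_INT ballI closed_Int closed_Collect_conj closed_Collect_le closed_Collect_eq ev
          continuous_on_const)
    finally show ?thesis .
  qed
  have S_ne: "S \<noteq> {}"
    using \<open>a \<le> b\<close> by (auto simp: S_def intro!: exI[of _ "const_bcontfun a"] simp: const_bcontfun.rep_eq)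
  have ex: "\<exists>v\<in>S. sol u v" if "u \<in> S" for u
  proof -
    let ?h = "\<lambda>x. H x (apply_bcontfun u x)"
    have u: "apply_bcontfun u x \<in> {a..b}" "apply_bcontfun u (x + P) = apply_bcontfun u x" for x
      using that by (auto simp: S_def)
    have "continuous_on UNIV (\<lambda>x. (\<lambda>(x, u). K x u) (x, apply_bcontfun u x))"
      by (rule continuous_on_compose2[OF cont]) (use u in \<open>auto intro!: continuous_intros\<close>)
    then have "continuous_on UNIV ?h"
      unfolding H_def by (auto intro!: continuous_intros)
    moreover have "?h (x + P) = ?h x" for x
      by (simp add: H_def per u)
    ultimately obtain v where v: "\<And>x. (v has_real_derivative L * v x - ?h x) (at x)"
        "\<And>x. v (x + P) = v x"
      using periodic_solution_linear[OF \<open>L > 0\<close> \<open>P > 0\<close>, of ?h] by blast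
    have hb: "?h x \<le> L * b" and ha: "L * a \<le> ?h x" for x
      using H_mono[of "apply_bcontfun u x" b x] H_mono[of a "apply_bcontfun u x" x] u[of x] Ka[of x] Kb[of x] \<open>a \<le> b\<close>
      by (auto simp: H_def)
    \<comment> \<open>The maximum principle with zero gain; applied to - v it yields the lower
      barrier.\<close>
    have vb: "v x \<le> b" for x
      using periodic_solution_linear_le[OF \<open>L > 0\<close> \<open>P > 0\<close> v, of "\<lambda>_. 0" "\<lambda>_. 0" 0 b x] hb by simp
    have nv: "((\<lambda>x. - v x) has_real_derivative L * - v x - - ?h x) (at x)" for x
      by (auto intro!: derivative_eq_intros v(1))
    have va: "a \<le> v x" for x
      using periodic_solution_linear_le[OF \<open>L > 0\<close> \<open>P > 0\<close> nv, of "\<lambda>_. 0" "\<lambda>_. 0" 0 "- a" x] ha v(2) by simp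
    have "continuous_on UNIV v"
      using v(1) DERIV_isCont by (auto simp: continuous_on_eq_continuous_at)
    then have "v \<in> bcontfun"
      by (rule bcontfun_normI[where b = "max \<bar>a\<bar> \<bar>b\<bar>"]) (use va vb in \<open>smt (verit) real_norm_def\<close>)
    then obtain w where w: "v = apply_bcontfun w" by (rule bcontfunE)
    show ?thesis
      using v va vb by (intro bexI[of _ w]) (auto simp: sol_def S_def w[symmetric])
  qed
  then obtain T where T: "\<And>u. u \<in> S \<Longrightarrow> T u \<in> S" "\<And>u. u \<in> S \<Longrightarrow> sol u (T u)"
    by metis
  \<comment> \<open>As m may vanish at some points, no pointwise factor is below 1; \<open>k\<close>
    is the gain from the mass c of m over a whole period.\<close>
  define k where "k = c * (exp (- L * P) / (1 - exp (- L * P)))"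
  have k: "k > 0" using assms by (simp add: k_def)
  have one_sided: "apply_bcontfun (T u) x - apply_bcontfun (T v) x \<le> (1 - k) * dist u v"
    if "u \<in> S" "v \<in> S" for u v x
  proof -
    let ?d = "dist u v"
    let ?u = "apply_bcontfun u" let ?v = "apply_bcontfun v"
    let ?w = "\<lambda>x. apply_bcontfun (T u) x - apply_bcontfun (T v) x"
    have w1: "(?w has_real_derivative L * ?w x - (H x (?u x) - H x (?v x))) (at x)" for x
      using T(2)[OF that(1)] T(2)[OF that(2)] unfolding sol_def
      by (auto intro!: derivative_eq_intros simp: algebra_simps)
    have w2: "?w (x + P) = ?w x" for x
      using T(1)[OF that(1)] T(1)[OF that(2)] unfolding S_def by simp
    have w3: "((\<lambda>x. ?d * M x) has_real_derivative ?d * m x) (at x)" for x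
      by (auto intro!: derivative_eq_intros M(1))
    have w4: "?d * M (x + P) = ?d * M x + ?d * c" for x
      by (simp add: M distrib_left mult.commute)
    \<comment> \<open>The growth of K enters only where u exceeds v. Elsewhere the left side is
      nonpositive by monotonicity and the right side is nonnegative because m \<le> L.\<close>
    have w5: "H x (?u x) - H x (?v x) \<le> L * ?d - ?d * m x" for x
    proof -
      have uv: "?u x \<in> {a..b}" "?v x \<in> {a..b}" using that by (auto simp: S_def)
      have d: "\<bar>?u x - ?v x\<bar> \<le> ?d"
        using dist_bounded[of u x v] by (simp add: dist_real_def)
      show ?thesis
      proof (cases "?v x < ?u x")
        case True
        then have "m x \<le> L" using mL uv by auto
        have "H x (?u x) - H x (?v x) \<le> (L - m x) * (?u x - ?v x)"
          using H_contr True uv by auto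
        also have "\<dots> \<le> (L - m x) * ?d"
          by (rule mult_left_mono) (use d \<open>m x \<le> L\<close> in auto)
        finally show ?thesis by (simp add: algebra_simps)
      next
        case False
        have *: "0 \<le> (L - m x) * ?d"
        proof (cases "a < b")
          case True
          then show ?thesis using mL[of x] by simp
        next
          case False
          then have "u = v" using that \<open>a \<le> b\<close>
            by (intro bcontfun_eqI) (force simp: S_def)
          then show ?thesis by simp
        qed
        have "H x (?u x) - H x (?v x) \<le> 0" using H_mono False uv by auto
        with * show ?thesis by (simp add: algebra_simps)
      qed
    qed
    have "?w x \<le> ?d - (?d * c) * (exp (- L * P) / (1 - exp (- L * P)))"
      by (rule periodic_solution_linear_le[OF \<open>L > 0\<close> \<open>P > 0\<close> w1 w2 w3 w4 _ w5]) (simp add: m)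
    then show ?thesis by (simp add: k_def algebra_simps)
  qed
  \<comment> \<open>Exchanging u and v turns the one-sided bound into a bound on the distance; the
    maximum with 0 supplies a nonnegative factor without comparing \<open>k\<close> with 1.\<close>
  have contr: "dist (T u) (T v) \<le> max 0 (1 - k) * dist u v" if "u \<in> S" "v \<in> S" for u v
  proof (rule dist_bound)
    fix x
    have "dist (apply_bcontfun (T u) x) (apply_bcontfun (T v) x) \<le> (1 - k) * dist u v"
      using one_sided[OF that, of x] one_sided[OF that(2,1), of x]
      by (auto simp: dist_real_def dist_commute)
    also have "\<dots> \<le> max 0 (1 - k) * dist u v"
      by (intro mult_right_mono) auto
    finally show "dist (apply_bcontfun (T u) x) (apply_bcontfun (T v) x) \<le> max 0 (1 - k) * dist u v" .
  qed
  have "\<exists>!u\<in>S. T u = u"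
    by (rule Banach_fix[of _ "max 0 (1 - k)"])
      (use S_closed S_ne k T(1) contr in \<open>auto simp: complete_eq_closed\<close>)
  then obtain u where "u \<in> S" "T u = u" by blast
  then show ?thesis
    using T(2)[of u] by (intro that[of "apply_bcontfun u"]) (auto simp: S_def sol_def H_def)
qed

section \<open>Motion along a circle with prescribed speed\<close>

lemma surj_if_deriv_ge:
  fixes f f' :: "real \<Rightarrow> real"
  assumes d: "\<And>x. (f has_real_derivative f' x) (at x)" and "\<delta> > 0" and ge: "\<And>x. \<delta> \<le> f' x"
  shows "surj f"
proof -
  have mono: "f s - \<delta> * s \<le> f t - \<delta> * t" if "s \<le> t" for s t
  proof (rule DERIV_nonneg_imp_nondecreasing[of s t "\<lambda>x. f x - \<delta> * x"])
    fix x
    have "((\<lambda>x. f x - \<delta> * x) has_real_derivative f' x - \<delta>) (at x)"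
      by (auto intro!: derivative_eq_intros d)
    then show "\<exists>y. ((\<lambda>x. f x - \<delta> * x) has_real_derivative y) (at x) \<and> 0 \<le> y"
      using ge[of x] by (intro exI[of _ "f' x - \<delta>"]) auto
  qed (use that in auto)
  have "\<exists>x. f x = y" for y
  proof -
    \<comment> \<open>Compared with the line of slope \<delta> through the value at 0, f must reach
      y within this distance of 0.\<close>
    define N where "N = \<bar>y - f 0\<bar> / \<delta>"
    have N: "0 \<le> N" "\<delta> * N = \<bar>y - f 0\<bar>" using \<open>\<delta> > 0\<close> by (auto simp: N_def)
    have "\<exists>x. - N \<le> x \<and> x \<le> N \<and> f x = y"
      by (rule IVT') (use N mono[of 0 N] mono[of "- N" 0] d DERIV_isCont in
        \<open>auto intro!: continuous_at_imp_continuous_on\<close>)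
    then show ?thesis by blast
  qed
  then show ?thesis unfolding surj_def by metis
qed

text \<open>Separation of variables: the integral of 1 / g is the time needed to reach an angle, and
  its inverse, run backwards, is the solution. The upper bound on g makes this time function onto,
  so the solution is global.\<close>

lemma autonomous_periodic_flow:
  fixes g :: "real \<Rightarrow> real"
  assumes cont: "continuous_on UNIV g" and "P > 0" and per: "\<And>x. g (x + P) = g x"
    and pos: "\<And>x. 0 < g x" and bound: "\<And>x. g x \<le> D"
  obtains \<theta> T where "T > 0" "\<And>t. (\<theta> has_real_derivative - g (\<theta> t)) (at t)"
    "\<And>t. \<theta> (t + T) = \<theta> t - P"
proof -
  have "continuous_on UNIV (\<lambda>x. 1 / g x)"
    by (intro continuous_intros cont) (use pos in \<open>auto simp: less_le\<close>)
  from continuous_imp_antiderivative[OF this] obtain F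
    where F: "\<And>x. (F has_real_derivative 1 / g x) (at x)"
    unfolding has_real_derivative_iff_has_vector_derivative by blast
  have "D > 0" using pos[of 0] bound[of 0] by simp
  have "surj F"
    by (rule surj_if_deriv_ge[OF F, of "1 / D"])
      (use \<open>D > 0\<close> pos bound in \<open>auto intro!: divide_left_mono\<close>)
  have incr: "F s < F t" if "s < t" for s t
    by (rule DERIV_pos_imp_increasing[OF that]) (use F pos in \<open>force intro!: exI[of _ "1 / g _"]\<close>)
  then have "inj F" by (metis injI less_irrefl linorder_neqE)
  define T where "T = F P - F 0"
  have "T > 0" using incr[OF \<open>P > 0\<close>] by (simp add: T_def)
  have shift: "F (x - P) = F x - T" for x
  proof -
    have "((\<lambda>y. F (y + P) - F y) has_real_derivative 1 / g (y + P) - 1 / g y) (at y)" for y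
      by (auto intro!: derivative_eq_intros DERIV_chain2[OF F, THEN DERIV_cong])
    then have "F (x - P + P) - F (x - P) = F (0 + P) - F 0"
      by (intro DERIV_isconst_all[of "\<lambda>y. F (y + P) - F y"]) (simp add: per)
    then show ?thesis by (simp add: T_def)
  qed
  let ?G = "inv F"
  have G: "F (?G y) = y" "?G (F x) = x" for x y
    using \<open>surj F\<close> \<open>inj F\<close> by (simp_all add: surj_f_inv_f)
  have contG: "isCont ?G y" for y
  proof -
    have "isCont ?G (F (?G y))"
      by (rule isCont_inverse_function2[of "?G y - 1" _ "?G y + 1"])
        (use F DERIV_isCont G in auto)
    then show ?thesis by (simp add: G)
  qed
  have dG: "(?G has_real_derivative g (?G y)) (at y)" for y
    using DERIV_inverse_function[OF F _ _ _ _ contG, of y "y - 1" "y + 1"] G pos[of "?G y"] by simp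
  show ?thesis
  proof (rule that[of T "\<lambda>t. ?G (- t)"])
    show "((\<lambda>t. ?G (- t)) has_real_derivative - g (?G (- t))) (at t)" for t
      by (auto intro!: derivative_eq_intros DERIV_chain2[OF dG, THEN DERIV_cong])
    show "?G (- (t + T)) = ?G (- t) - P" for t
    proof -
      have "F (?G (- t) - P) = - (t + T)" by (simp add: shift G)
      then show ?thesis using G by metis
    qed
  qed fact
qed

section \<open>Polar coordinates along a planar curve, and the equilibrium\<close>

text \<open>With z = x + i y, the real and imaginary parts of z' / z are integrated to w and
  \<theta>. This gives a continuous angle without choosing branches of the argument; what remains is
  that z exp (- w - i \<theta>) is constantly 1.\<close>

lemma polar_lift:
  fixes x y :: "real \<Rightarrow> real"
  assumes x: "\<And>t. (x has_real_derivative x' t) (at t)" and y: "\<And>t. (y has_real_derivative y' t) (at t)"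
    and cont: "continuous_on UNIV x'" "continuous_on UNIV y'"
    and nz: "\<And>t. (x t)\<^sup>2 + (y t)\<^sup>2 \<noteq> 0"
  obtains w \<theta> where "\<And>t. x t = exp (w t) * cos (\<theta> t)" "\<And>t. y t = exp (w t) * sin (\<theta> t)"
    "\<And>t. (w has_real_derivative (x t * x' t + y t * y' t) / ((x t)\<^sup>2 + (y t)\<^sup>2)) (at t)"
    "\<And>t. (\<theta> has_real_derivative (x t * y' t - y t * x' t) / ((x t)\<^sup>2 + (y t)\<^sup>2)) (at t)"
proof -
  let ?r = "\<lambda>t. (x t)\<^sup>2 + (y t)\<^sup>2"
  define a where "a t = (x t * x' t + y t * y' t) / ?r t" for t
  define b where "b t = (x t * y' t - y t * x' t) / ?r t" for t
  have cxy: "continuous_on UNIV x" "continuous_on UNIV y"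
    using DERIV_isCont[OF x] DERIV_isCont[OF y] by (auto simp: continuous_on_eq_continuous_at)
  have "continuous_on UNIV a" "continuous_on UNIV b"
    unfolding a_def b_def by (intro continuous_intros cxy cont ballI nz)+
  then obtain w0 \<theta>0 where w0: "\<And>t. (w0 has_real_derivative a t) (at t)"
    and \<theta>0: "\<And>t. (\<theta>0 has_real_derivative b t) (at t)"
    unfolding has_real_derivative_iff_has_vector_derivative
    by (meson continuous_imp_antiderivative)
  have r0: "?r 0 > 0" using nz[of 0] by (smt (verit) zero_le_power2)
  then have "(x 0 / sqrt (?r 0))\<^sup>2 + (y 0 / sqrt (?r 0))\<^sup>2 = 1"
    unfolding power_divide add_divide_distrib[symmetric] by auto
  then obtain \<alpha> where \<alpha>: "x 0 / sqrt (?r 0) = cos \<alpha>" "y 0 / sqrt (?r 0) = sin \<alpha>"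
    using sincos_total_2pi by metis
  \<comment> \<open>The integration constants match modulus and argument of z at time 0.\<close>
  define w where "w t = w0 t - w0 0 + ln (sqrt (?r 0))" for t
  define \<theta> where "\<theta> t = \<theta>0 t - \<theta>0 0 + \<alpha>" for t
  have w: "(w has_real_derivative a t) (at t)" for t
    unfolding w_def by (auto intro!: derivative_eq_intros w0)
  have \<theta>: "(\<theta> has_real_derivative b t) (at t)" for t
    unfolding \<theta>_def by (auto intro!: derivative_eq_intros \<theta>0)
  have x': "x' t = a t * x t - b t * y t" and y': "y' t = a t * y t + b t * x t" for t
  proof -
    have a: "a t * ?r t = x t * x' t + y t * y' t" and b: "b t * ?r t = x t * y' t - y t * x' t"
      using nz[of t] by (simp_all add: a_def b_def)
    have "(a t * x t - b t * y t) * ?r t = (a t * ?r t) * x t - (b t * ?r t) * y t"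
      by (simp add: algebra_simps)
    also have "\<dots> = x' t * ?r t"
      unfolding a b by (simp add: power2_eq_square algebra_simps)
    finally show "x' t = a t * x t - b t * y t" using nz[of t] by auto
    have "(a t * y t + b t * x t) * ?r t = (a t * ?r t) * y t + (b t * ?r t) * x t"
      by (simp add: algebra_simps)
    also have "\<dots> = y' t * ?r t"
      unfolding a b by (simp add: power2_eq_square algebra_simps)
    finally show "y' t = a t * y t + b t * x t" using nz[of t] by auto
  qed
  \<comment> \<open>\<open>p\<close> and \<open>s\<close> are the real and imaginary parts of z exp
    (- w - i \<theta>).\<close>
  define p where "p t = exp (- w t) * (x t * cos (\<theta> t) + y t * sin (\<theta> t))" for t
  define s where "s t = exp (- w t) * (y t * cos (\<theta> t) - x t * sin (\<theta> t))" for t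
  have "(p has_real_derivative 0) (at t)" for t
    unfolding p_def by (auto intro!: derivative_eq_intros x y w \<theta>) (simp add: x' y' algebra_simps)
  then have "p t = p 0" for t by (intro DERIV_isconst_all) auto
  moreover have "(s has_real_derivative 0) (at t)" for t
    unfolding s_def by (auto intro!: derivative_eq_intros x y w \<theta>) (simp add: x' y' algebra_simps)
  then have "s t = s 0" for t by (intro DERIV_isconst_all) auto
  moreover have "p 0 = 1" "s 0 = 0"
  proof -
    have e: "exp (- w 0) = 1 / sqrt (?r 0)" using r0 by (simp add: w_def exp_minus field_simps)
    have "p 0 = (x 0 / sqrt (?r 0)) * cos \<alpha> + (y 0 / sqrt (?r 0)) * sin \<alpha>"
      unfolding p_def e by (simp add: \<theta>_def add_divide_distrib algebra_simps)
    also have "\<dots> = 1" unfolding \<alpha> by (simp add: power2_eq_square[symmetric])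
    finally show "p 0 = 1" .
    have "s 0 = (y 0 / sqrt (?r 0)) * cos \<alpha> - (x 0 / sqrt (?r 0)) * sin \<alpha>"
      unfolding s_def e by (simp add: \<theta>_def diff_divide_distrib algebra_simps)
    also have "\<dots> = 0" unfolding \<alpha> by simp
    finally show "s 0 = 0" .
  qed
  ultimately have p: "p t = 1" and s: "s t = 0" for t by auto
  have rotate: "E * (F * (X * c + Y * d) * c - F * (Y * c - X * d) * d) = E * F * (X * (d\<^sup>2 + c\<^sup>2))"
    "E * (F * (X * c + Y * d) * d + F * (Y * c - X * d) * c) = E * F * (Y * (d\<^sup>2 + c\<^sup>2))"
    for E F X Y c d :: real
    by (simp_all add: power2_eq_square algebra_simps)
  have xt: "x t = exp (w t) * cos (\<theta> t)" for t
  proof -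
    have "exp (w t) * (p t * cos (\<theta> t) - s t * sin (\<theta> t))
        = (exp (w t) * exp (- w t)) * (x t * ((sin (\<theta> t))\<^sup>2 + (cos (\<theta> t))\<^sup>2))"
      unfolding p_def s_def by (rule rotate)
    then show ?thesis unfolding p s sin_cos_squared_add by (simp add: exp_minus)
  qed
  have yt: "y t = exp (w t) * sin (\<theta> t)" for t
  proof -
    have "exp (w t) * (p t * sin (\<theta> t) + s t * cos (\<theta> t))
        = (exp (w t) * exp (- w t)) * (y t * ((sin (\<theta> t))\<^sup>2 + (cos (\<theta> t))\<^sup>2))"
      unfolding p_def s_def by (rule rotate)
    then show ?thesis unfolding p s sin_cos_squared_add by (simp add: exp_minus)
  qed
  show ?thesis by (rule that[OF xt yt w[unfolded a_def] \<theta>[unfolded b_def]])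
qed

text \<open>Gronwall in both time directions: along a fixed solution the damping is a given
  continuous function of time, and the squared radius r satisfies |r'| \<le> 2 |\<phi>| r. Hence
  nonconstant orbits avoid the origin and polar coordinates apply to them.\<close>

lemma solves_system_stays_zero:
  assumes sol: "solves_system x y" and zero: "(x a)\<^sup>2 + (y a)\<^sup>2 = 0"
  shows "(x t)\<^sup>2 + (y t)\<^sup>2 = 0"
proof -
  define \<phi> where "\<phi> t = (x t)\<^sup>2 + (x t + y t)\<^sup>2 - 1" for t
  have x: "(x has_real_derivative y t) (at t)" and y: "(y has_real_derivative - \<phi> t * y t - x t) (at t)" for t
    using sol by (auto simp: solves_system_def \<phi>_def)
  have cxy: "continuous_on UNIV x" "continuous_on UNIV y"
    using DERIV_isCont[OF x] DERIV_isCont[OF y] by (auto simp: continuous_on_eq_continuous_at)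
  have "continuous_on UNIV (\<lambda>t. 2 * \<bar>\<phi> t\<bar>)"
    unfolding \<phi>_def by (intro continuous_intros cxy)
  from continuous_imp_antiderivative[OF this] obtain F
    where F: "\<And>t. (F has_real_derivative 2 * \<bar>\<phi> t\<bar>) (at t)"
    unfolding has_real_derivative_iff_has_vector_derivative by blast
  let ?r = "\<lambda>t. (x t)\<^sup>2 + (y t)\<^sup>2"
  have r: "(?r has_real_derivative - 2 * \<phi> t * (y t)\<^sup>2) (at t)" for t
    by (auto intro!: derivative_eq_intros x y simp: power2_eq_square algebra_simps)
  have bound: "\<bar>2 * \<phi> t * (y t)\<^sup>2\<bar> \<le> 2 * \<bar>\<phi> t\<bar> * ?r t" for t
    by (auto simp: abs_mult intro!: mult_left_mono)
  have "?r t \<le> 0"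
  proof (cases "t \<le> a")
    case True
    let ?f = "\<lambda>t. exp (F t) * ?r t"
    have "?f t \<le> ?f a"
    proof (rule DERIV_nonneg_imp_nondecreasing[OF True, of ?f])
      fix t
      have "(?f has_real_derivative exp (F t) * (2 * \<bar>\<phi> t\<bar> * ?r t - 2 * \<phi> t * (y t)\<^sup>2)) (at t)"
        by (rule derivative_eq_intros F r refl)+ (simp add: algebra_simps)
      moreover have "0 \<le> exp (F t) * (2 * \<bar>\<phi> t\<bar> * ?r t - 2 * \<phi> t * (y t)\<^sup>2)"
        using bound[of t] by (intro mult_nonneg_nonneg) auto
      ultimately show "\<exists>z. (?f has_real_derivative z) (at t) \<and> 0 \<le> z" by blast
    qed
    then show ?thesis by (simp add: zero mult_le_0_iff)
  next
    case False
    let ?f = "\<lambda>t. exp (- F t) * ?r t"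
    have "?f t \<le> ?f a"
    proof (rule DERIV_nonpos_imp_nonincreasing[of a t ?f])
      fix t
      have "(?f has_real_derivative exp (- F t) * (- 2 * \<phi> t * (y t)\<^sup>2 - 2 * \<bar>\<phi> t\<bar> * ?r t)) (at t)"
        by (rule derivative_eq_intros F r refl)+ (simp add: algebra_simps)
      moreover have "exp (- F t) * (- 2 * \<phi> t * (y t)\<^sup>2 - 2 * \<bar>\<phi> t\<bar> * ?r t) \<le> 0"
        using bound[of t] by (intro mult_nonneg_nonpos) auto
      ultimately show "\<exists>z. (?f has_real_derivative z) (at t) \<and> z \<le> 0" by blast
    qed (use False in auto)
    then show ?thesis by (simp add: zero mult_le_0_iff)
  qed
  then show ?thesis by (smt (verit) zero_le_power2)
qed

text \<open>Polar coordinates with \<open>u = ln (x\<^sup>2 + y\<^sup>2)\<close>; orbits turn clockwise, so \<open>angular_speed\<close> is \<open>- \<theta>'\<close>.\<close>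

definition quad :: "real \<Rightarrow> real" where
  "quad \<theta> = (cos \<theta>)\<^sup>2 + (cos \<theta> + sin \<theta>)\<^sup>2"

definition damping :: "real \<Rightarrow> real \<Rightarrow> real" where
  "damping \<theta> u = quad \<theta> * exp u - 1"

definition angular_speed :: "real \<Rightarrow> real \<Rightarrow> real" where
  "angular_speed \<theta> u = 1 + sin \<theta> * cos \<theta> * damping \<theta> u"

definition radial_slope :: "real \<Rightarrow> real \<Rightarrow> real" where
  "radial_slope \<theta> u = 2 * (sin \<theta>)\<^sup>2 * damping \<theta> u / angular_speed \<theta> u"

section \<open>Estimates in the annulus\<close>

text \<open>The sharp constants are the eigenvalues (3 - sqrt 5) / 2 and (3 + sqrt 5) / 2 of the
  quadratic form. The rational ones are the reciprocals of rho on the two boundary circles, which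
  fixes the sign of \<open>damping\<close> there.\<close>

lemma quad_bounds: "3 / 8 \<le> quad \<theta>" "quad \<theta> \<le> 3"
proof -
  have lower: "C\<^sup>2 + (C + S)\<^sup>2 = 3 / 8 * (S\<^sup>2 + C\<^sup>2) + (13 / 8 * (C + 8 / 13 * S)\<^sup>2 + 1 / 104 * S\<^sup>2)"
    and upper: "C\<^sup>2 + (C + S)\<^sup>2 = 3 * (S\<^sup>2 + C\<^sup>2) - ((C - S)\<^sup>2 + S\<^sup>2)" for S C :: real
    by (simp_all add: power2_eq_square field_simps)
  show "3 / 8 \<le> quad \<theta>" unfolding quad_def lower sin_cos_squared_add by simp
  show "quad \<theta> \<le> 3" unfolding quad_def upper sin_cos_squared_add by simp
qed

lemma abs_sin_cos_le: "\<bar>sin \<theta> * cos \<theta>\<bar> \<le> 1 / 2" for \<theta> :: real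
  using abs_sin_le_one[of "2 * \<theta>"] unfolding sin_double by (simp add: abs_mult)

lemma exp_bounds:
  assumes "u \<in> {ln (1/3)..ln (8/3)}"
  shows "1 / 3 \<le> exp u" "exp u \<le> (8 / 3 :: real)"
proof -
  have "exp (ln (1/3)) \<le> exp u" "exp u \<le> exp (ln (8/3))"
    unfolding exp_le_cancel_iff using assms by auto
  then show "1 / 3 \<le> exp u" "exp u \<le> (8 / 3 :: real)" by simp_all
qed

text \<open>The speed is affine in exp u, so it suffices to bound it at exp u = 0 and exp u = 8/3.
  At 8/3 the relation S^2 + C^2 = 1 turns the claim into nonnegativity of a quartic form.\<close>

lemma angular_speed_ge:
  assumes "exp u \<le> 8 / 3"
  shows "1 / 8 \<le> angular_speed \<theta> u"
proof -
  define S C where "S = sin \<theta>" and "C = cos \<theta>"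
  have SC: "S\<^sup>2 + C\<^sup>2 = 1" by (simp add: S_def C_def)
  have "1 + S * C * (8 / 3 * quad \<theta> - 1) - 1 / 8
      = 7 / 8 * (S\<^sup>2 + C\<^sup>2)\<^sup>2 + S * C * (8 / 3 * (C\<^sup>2 + (C + S)\<^sup>2) - (S\<^sup>2 + C\<^sup>2))"
    by (simp add: SC quad_def S_def C_def)
  \<comment> \<open>The square matches the terms in C^4, C^3 S and C S^3, which determines 52/21 and
    5/13; the other two terms are left with positive coefficients.\<close>
  also have "\<dots> = 7 / 8 * (C\<^sup>2 + 52 / 21 * C * S + 5 / 13 * S\<^sup>2)\<^sup>2
      + 856 / 819 * (C\<^sup>2 * S\<^sup>2) + 126 / 169 * (S\<^sup>2)\<^sup>2"
    by (simp add: power2_eq_square field_simps)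
  also have "\<dots> \<ge> 0"
    by (intro add_nonneg_nonneg mult_nonneg_nonneg) (auto simp: power2_eq_square)
  finally have outer: "1 / 8 \<le> 1 + S * C * (8 / 3 * quad \<theta> - 1)" by linarith
  have inner: "1 / 8 \<le> 1 - S * C"
    using abs_sin_cos_le[of \<theta>] by (simp add: S_def C_def)
  have "angular_speed \<theta> u = (1 - 3 / 8 * exp u) * (1 - S * C)
      + 3 / 8 * exp u * (1 + S * C * (8 / 3 * quad \<theta> - 1))"
    by (simp add: angular_speed_def damping_def S_def C_def field_simps)
  also have "\<dots> \<ge> (1 - 3 / 8 * exp u) * (1 / 8) + 3 / 8 * exp u * (1 / 8)"
    by (intro add_mono mult_left_mono inner outer) (use assms in auto)
  finally show ?thesis by (simp add: algebra_simps)
qed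

lemma angular_speed_le:
  assumes "exp u \<le> 8 / 3"
  shows "angular_speed \<theta> u \<le> 5"
proof -
  have "quad \<theta> * exp u \<le> 3 * (8 / 3)"
    by (rule mult_mono) (use quad_bounds assms in auto)
  moreover have "0 \<le> quad \<theta> * exp u"
    using quad_bounds(1)[of \<theta>] by (intro mult_nonneg_nonneg) auto
  ultimately have "\<bar>damping \<theta> u\<bar> \<le> 8" by (simp add: damping_def)
  then have "\<bar>sin \<theta> * cos \<theta>\<bar> * \<bar>damping \<theta> u\<bar> \<le> 1 / 2 * 8"
    by (intro mult_mono abs_sin_cos_le) auto
  then show ?thesis by (simp add: angular_speed_def abs_mult[symmetric])
qed

text \<open>The slope is 2 sin^2 \<theta> times a Moebius function of \<open>damping\<close> with
  determinant 1, so in the difference the products of the two damping values cancel.\<close>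

lemma radial_slope_diff:
  assumes "angular_speed \<theta> u \<noteq> 0" "angular_speed \<theta> v \<noteq> 0"
  shows "radial_slope \<theta> v - radial_slope \<theta> u
    = 2 * (sin \<theta>)\<^sup>2 * quad \<theta> * (exp v - exp u) / (angular_speed \<theta> v * angular_speed \<theta> u)"
proof -
  have "damping \<theta> v * angular_speed \<theta> u - damping \<theta> u * angular_speed \<theta> v = quad \<theta> * (exp v - exp u)"
    by (simp add: angular_speed_def damping_def algebra_simps)
  moreover have "radial_slope \<theta> v - radial_slope \<theta> u
    = 2 * (sin \<theta>)\<^sup>2 * (damping \<theta> v * angular_speed \<theta> u - damping \<theta> u * angular_speed \<theta> v)
        / (angular_speed \<theta> v * angular_speed \<theta> u)"
    using assms by (simp add: radial_slope_def diff_frac_eq) (simp add: algebra_simps)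
  ultimately show ?thesis by (simp add: mult.assoc)
qed

lemma exp_diff_bounds:
  fixes u v :: real
  shows "exp u * (v - u) \<le> exp v - exp u" "exp v - exp u \<le> exp v * (v - u)"
proof -
  have "exp u * (1 + (v - u)) \<le> exp u * exp (v - u)" "exp v * (1 + (u - v)) \<le> exp v * exp (u - v)"
    by (intro mult_left_mono exp_ge_add_one_self; simp)+
  then show "exp u * (v - u) \<le> exp v - exp u" "exp v - exp u \<le> exp v * (v - u)"
    by (simp_all add: exp_add[symmetric] algebra_simps)
qed

text \<open>The product of the two speeds lies between 1/64 and 25, and
  \<open>quad \<theta> * (exp v - exp u)\<close> between 1/8 and 8 times v - u; thus 1/100 = 2 / 8 /
  25 and 1024 = 2 * 8 * 64. The sine must stay in the lower bound since it can vanish.\<close>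

lemma radial_slope_bounds:
  assumes uv: "u \<in> {ln (1/3)..ln (8/3)}" "v \<in> {ln (1/3)..ln (8/3)}" "u \<le> v"
  shows "(sin \<theta>)\<^sup>2 / 100 * (v - u) \<le> radial_slope \<theta> v - radial_slope \<theta> u"
    and "radial_slope \<theta> v - radial_slope \<theta> u \<le> 1024 * (v - u)"
proof -
  note e = exp_bounds[OF uv(1)] exp_bounds[OF uv(2)]
  define A where "A = angular_speed \<theta> v * angular_speed \<theta> u"
  note a = angular_speed_ge[OF e(2), of \<theta>] angular_speed_ge[OF e(4), of \<theta>]
    angular_speed_le[OF e(2), of \<theta>] angular_speed_le[OF e(4), of \<theta>]
  have A: "1 / 8 * (1 / 8) \<le> A" "A \<le> 5 * 5"
    unfolding A_def by (intro mult_mono; use a in simp)+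
  let ?X = "quad \<theta> * (exp v - exp u)"
  have "3 / 8 * (1 / 3 * (v - u)) \<le> 3 / 8 * (exp u * (v - u))"
    by (intro mult_left_mono mult_right_mono) (use e uv in auto)
  also have "\<dots> \<le> quad \<theta> * (exp v - exp u)"
    by (intro mult_mono exp_diff_bounds quad_bounds) (use uv quad_bounds(1)[of \<theta>] in auto)
  finally have X1: "(v - u) / 8 \<le> ?X" by simp
  have "?X \<le> 3 * (exp v * (v - u))"
    by (intro mult_mono exp_diff_bounds quad_bounds) (use uv in auto)
  also have "\<dots> \<le> 3 * (8 / 3 * (v - u))"
    by (intro mult_left_mono mult_right_mono) (use e uv in auto)
  finally have X2: "?X \<le> 8 * (v - u)" by simp
  have eq: "radial_slope \<theta> v - radial_slope \<theta> u = (sin \<theta>)\<^sup>2 * (2 * ?X / A)"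
    using a unfolding A_def by (subst radial_slope_diff) (auto simp: mult_ac)
  have "(v - u) / 100 \<le> 2 * ?X / A"
  proof -
    have "(v - u) / 100 * A \<le> (v - u) / 100 * 25" using A uv by (intro mult_left_mono) auto
    also have "\<dots> \<le> 2 * ?X" using X1 by simp
    finally show ?thesis using A by (simp add: le_divide_eq)
  qed
  then have "(sin \<theta>)\<^sup>2 * ((v - u) / 100) \<le> (sin \<theta>)\<^sup>2 * (2 * ?X / A)"
    by (rule mult_left_mono) simp
  then show "(sin \<theta>)\<^sup>2 / 100 * (v - u) \<le> radial_slope \<theta> v - radial_slope \<theta> u"
    unfolding eq by simp
  have up: "2 * ?X / A \<le> 1024 * (v - u)"
  proof -
    have "2 * ?X \<le> 1024 * (v - u) * (1 / 64)" using X2 by simp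
    also have "\<dots> \<le> 1024 * (v - u) * A" using A uv by (intro mult_left_mono) auto
    finally show ?thesis using A by (simp add: divide_le_eq)
  qed
  have "0 \<le> 2 * ?X / A" using A X1 uv by (intro divide_nonneg_nonneg) auto
  moreover have "(sin \<theta>)\<^sup>2 \<le> 1" by (simp add: abs_square_le_1)
  ultimately have "(sin \<theta>)\<^sup>2 * (2 * ?X / A) \<le> 1 * (2 * ?X / A)"
    by (intro mult_right_mono)
  with up show "radial_slope \<theta> v - radial_slope \<theta> u \<le> 1024 * (v - u)"
    unfolding eq by simp
qed

lemma continuous_on_polar:
  "continuous_on (UNIV \<times> {ln (1/3)..ln (8/3)}) (\<lambda>(\<theta>, u). angular_speed \<theta> u)"
  "continuous_on (UNIV \<times> {ln (1/3)..ln (8/3)}) (\<lambda>(\<theta>, u). radial_slope \<theta> u)"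
proof -
  have "angular_speed \<theta> u \<noteq> 0" if "u \<in> {ln (1/3)..ln (8/3)}" for \<theta> u
    using angular_speed_ge[OF exp_bounds(2)[OF that], of \<theta>] by simp
  moreover have A: "continuous_on B (\<lambda>p. angular_speed (fst p) (snd p))" for B
    unfolding angular_speed_def damping_def quad_def by (intro continuous_intros)
  moreover have "continuous_on B (\<lambda>p. 2 * (sin (fst p))\<^sup>2 * damping (fst p) (snd p))" for B
    unfolding damping_def quad_def by (intro continuous_intros)
  ultimately show "continuous_on (UNIV \<times> {ln (1/3)..ln (8/3)}) (\<lambda>(\<theta>, u). angular_speed \<theta> u)"
    "continuous_on (UNIV \<times> {ln (1/3)..ln (8/3)}) (\<lambda>(\<theta>, u). radial_slope \<theta> u)"
    unfolding radial_slope_def case_prod_beta by (auto intro!: continuous_on_divide)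
qed

lemma polar_periodic:
  "angular_speed (\<theta> + 2 * pi) u = angular_speed \<theta> u"
  "radial_slope (\<theta> + 2 * pi) u = radial_slope \<theta> u"
  by (simp_all add: radial_slope_def angular_speed_def damping_def quad_def)

section \<open>The cycle as a function of the angle and as a solution in time\<close>

definition polar_cycle :: "(real \<Rightarrow> real) \<Rightarrow> bool" where
  "polar_cycle u \<longleftrightarrow>
     (\<forall>\<theta>. (u has_real_derivative radial_slope \<theta> (u \<theta>)) (at \<theta>) \<and>
       u (\<theta> + 2 * pi) = u \<theta> \<and> u \<theta> \<in> {ln (1/3)..ln (8/3)})"

lemma polar_cycle_exists: "\<exists>u. polar_cycle u"
proof -
  let ?a = "ln (1/3 :: real)" and ?b = "ln (8/3 :: real)"
  have ab: "?a \<le> ?b" by simp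
  have nonpos: "radial_slope \<theta> ?a \<le> 0" for \<theta>
  proof -
    have "damping \<theta> ?a \<le> 0" using quad_bounds[of \<theta>] by (simp add: damping_def)
    moreover have "1 / 8 \<le> angular_speed \<theta> ?a" by (rule angular_speed_ge) simp
    ultimately show ?thesis unfolding radial_slope_def
      by (intro divide_nonpos_pos mult_nonneg_nonpos) auto
  qed
  have nonneg: "0 \<le> radial_slope \<theta> ?b" for \<theta>
  proof -
    have "0 \<le> damping \<theta> ?b" using quad_bounds[of \<theta>] by (simp add: damping_def)
    moreover have "1 / 8 \<le> angular_speed \<theta> ?b" by (rule angular_speed_ge) simp
    ultimately show ?thesis unfolding radial_slope_def by auto
  qed
  \<comment> \<open>An antiderivative of the growth rate sin^2 \<theta> / 100; its increase over a
    turn, pi / 100, is the positive mass that drives the contraction.\<close>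
  let ?M = "\<lambda>\<theta>::real. (\<theta> - sin \<theta> * cos \<theta>) / 200"
  have M: "(?M has_real_derivative (sin \<theta>)\<^sup>2 / 100) (at \<theta>)" for \<theta>
  proof -
    have "(?M has_real_derivative (1 - (cos \<theta> * cos \<theta> + - sin \<theta> * sin \<theta>)) / 200) (at \<theta>)"
      by (auto intro!: derivative_eq_intros)
    moreover have "1 - (cos \<theta> * cos \<theta> + - sin \<theta> * sin \<theta>) = 2 * (sin \<theta>)\<^sup>2"
      using sin_cos_squared_add[of \<theta>] by (simp add: power2_eq_square)
    ultimately show ?thesis by simp
  qed
  have M_shift: "?M (\<theta> + 2 * pi) = ?M \<theta> + pi / 100" for \<theta>
    by (simp add: add_divide_distrib diff_divide_distrib)
  obtain u where "\<And>\<theta>. (u has_real_derivative radial_slope \<theta> (u \<theta>)) (at \<theta>)"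
    "\<And>\<theta>. u (\<theta> + 2 * pi) = u \<theta>" "\<And>\<theta>. u \<theta> \<in> {?a..?b}"
    by (rule periodic_solution[of 1024 "2 * pi" ?a ?b "pi / 100" radial_slope,
          OF _ _ ab _ continuous_on_polar(2) polar_periodic(2) nonpos nonneg M M_shift])
      (use radial_slope_bounds in auto)
  then show ?thesis unfolding polar_cycle_def by blast
qed

definition polar_curve :: "(real \<Rightarrow> real) \<Rightarrow> real \<Rightarrow> real \<times> real" where
  "polar_curve u \<theta> = (exp (u \<theta> / 2) * cos \<theta>, exp (u \<theta> / 2) * sin \<theta>)"

lemma damping_cartesian:
  "(exp w * cos \<theta>)\<^sup>2 + (exp w * cos \<theta> + exp w * sin \<theta>)\<^sup>2 - 1 = damping \<theta> (2 * w)"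
  unfolding damping_def quad_def exp_double by (simp add: power2_eq_square algebra_simps)

lemma polar_cycle_solution:
  assumes "polar_cycle u"
  obtains x y where "solves_system x y" "nonconst_periodic (\<lambda>t. (x t, y t))"
proof -
  have u: "(u has_real_derivative radial_slope \<theta> (u \<theta>)) (at \<theta>)"
    "u (\<theta> + 2 * pi) = u \<theta>" "u \<theta> \<in> {ln (1/3)..ln (8/3)}" for \<theta>
    using assms by (auto simp: polar_cycle_def)
  let ?A = "\<lambda>\<theta>. angular_speed \<theta> (u \<theta>)"
  have "continuous_on UNIV u"
    using DERIV_isCont[OF u(1)] by (auto simp: continuous_on_eq_continuous_at)
  then have "continuous_on UNIV (\<lambda>\<theta>. (\<lambda>(\<theta>, u). angular_speed \<theta> u) (\<theta>, u \<theta>))"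
    by (intro continuous_on_compose2[OF continuous_on_polar(1)] continuous_intros)
      (use u(3) in auto)
  then have cont: "continuous_on UNIV ?A" by simp
  have A: "1 / 8 \<le> ?A \<theta>" "?A \<theta> \<le> 5" for \<theta>
    using angular_speed_ge angular_speed_le exp_bounds(2)[OF u(3)] by auto
  have pos: "0 < ?A \<theta>" for \<theta> using A(1)[of \<theta>] by linarith
  have per: "?A (\<theta> + 2 * pi) = ?A \<theta>" for \<theta> by (simp only: u(2) polar_periodic)
  have "0 < 2 * pi" by simp
  from autonomous_periodic_flow[of ?A "2 * pi" 5, OF cont this per pos A(2)]
  obtain \<theta> T where "T > 0" and \<theta>: "\<And>t. (\<theta> has_real_derivative - ?A (\<theta> t)) (at t)"
    and shift: "\<And>t. \<theta> (t + T) = \<theta> t - 2 * pi"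
    by metis
  define w where "w t = u (\<theta> t) / 2" for t
  define x where "x t = exp (w t) * cos (\<theta> t)" for t
  define y where "y t = exp (w t) * sin (\<theta> t)" for t
  define D where "D t = damping (\<theta> t) (2 * w t)" for t
  have \<theta>': "(\<theta> has_real_derivative - (1 + sin (\<theta> t) * cos (\<theta> t) * D t)) (at t)" for t
    using \<theta>[of t] by (simp add: D_def w_def angular_speed_def)
  \<comment> \<open>In the chain rule the angular speed cancels against the denominator of the
    slope.\<close>
  have w: "(w has_real_derivative - (sin (\<theta> t))\<^sup>2 * D t) (at t)" for t
  proof -
    have "(w has_real_derivative radial_slope (\<theta> t) (u (\<theta> t)) * - ?A (\<theta> t) / 2) (at t)"
      unfolding w_def by (intro DERIV_cdivide DERIV_chain2[OF u(1) \<theta>])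
    moreover have "radial_slope (\<theta> t) (u (\<theta> t)) * - ?A (\<theta> t) / 2 = - (sin (\<theta> t))\<^sup>2 * D t"
      using A(1)[of "\<theta> t"] by (simp add: radial_slope_def D_def w_def)
    ultimately show ?thesis by simp
  qed
  have sol: "solves_system x y"
    unfolding solves_system_def
  proof (intro conjI allI)
    fix t
    let ?S = "sin (\<theta> t)" and ?C = "cos (\<theta> t)"
    have D: "(x t)\<^sup>2 + (x t + y t)\<^sup>2 - 1 = D t"
      unfolding x_def y_def D_def by (rule damping_cartesian)
    have "(x has_real_derivative exp (w t) * (- ?S\<^sup>2 * D t * ?C + ?S * (1 + ?S * ?C * D t))) (at t)"
      unfolding x_def by (auto intro!: derivative_eq_intros w \<theta>' simp: algebra_simps)
    then show "(x has_real_derivative y t) (at t)"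
      by (simp add: y_def algebra_simps power2_eq_square)
    have "(y has_real_derivative exp (w t) * (- ?S\<^sup>2 * D t * ?S - ?C * (1 + ?S * ?C * D t))) (at t)"
      unfolding y_def by (auto intro!: derivative_eq_intros w \<theta>' simp: algebra_simps)
    moreover have "- S\<^sup>2 * d * S - C * (1 + S * C * d) = - d * S * (S\<^sup>2 + C\<^sup>2) - C" for S C d :: real
      by (simp add: power2_eq_square algebra_simps)
    then have "- ?S\<^sup>2 * D t * ?S - ?C * (1 + ?S * ?C * D t) = - D t * ?S - ?C"
      by (simp only: sin_cos_squared_add mult_1_right)
    ultimately have "(y has_real_derivative exp (w t) * (- D t * ?S - ?C)) (at t)"
      by simp
    then show "(y has_real_derivative - ((x t)\<^sup>2 + (x t + y t)\<^sup>2 - 1) * y t - x t) (at t)"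
      unfolding D by (simp add: x_def y_def algebra_simps)
  qed
  have "w (t + T) = w t" for t
    using u(2)[of "\<theta> t - 2 * pi"] by (simp add: w_def shift)
  then have "periodic_fun_simple (\<lambda>t. (x t, y t)) T"
    by unfold_locales (simp add: x_def y_def shift cos_diff sin_diff)
  \<comment> \<open>A constant solution is the equilibrium at the origin, but the radius exp (w t)
    is positive.\<close>
  moreover have "\<not> (\<lambda>t. (x t, y t)) constant_on UNIV"
  proof
    assume "(\<lambda>t. (x t, y t)) constant_on UNIV"
    then obtain a b where ab: "x = (\<lambda>_. a)" "y = (\<lambda>_. b)"
      by (auto simp: constant_on_def fun_eq_iff)
    have "b = 0"
      using sol DERIV_unique[of x b 0 0] unfolding solves_system_def ab by auto
    then have "a = 0"
      using sol DERIV_unique[of y "- a" 0 0] unfolding solves_system_def ab by auto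
    then have "cos (\<theta> 0) = 0" "sin (\<theta> 0) = 0"
      using \<open>b = 0\<close> fun_cong[OF ab(1), of 0] fun_cong[OF ab(2), of 0] by (auto simp: x_def y_def)
    then show False using sin_cos_squared_add[of "\<theta> 0"] by simp
  qed
  ultimately have "nonconst_periodic (\<lambda>t. (x t, y t))"
    using \<open>T > 0\<close> by (auto simp: nonconst_periodic_def)
  with sol show ?thesis by (rule that)
qed

section \<open>Uniqueness of the periodic orbit\<close>

lemma nonconst_periodic_orbit_unique:
  assumes "polar_cycle u" and "nonconst_periodic_orbit \<Gamma>"
  shows "\<Gamma> = range (polar_curve u)"
proof -
  have u: "(u has_real_derivative radial_slope \<theta> (u \<theta>)) (at \<theta>)"
    "u (\<theta> + 2 * pi) = u \<theta>" "u \<theta> \<in> {ln (1/3)..ln (8/3)}" for \<theta>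
    using assms(1) by (auto simp: polar_cycle_def)
  interpret u: periodic_fun_simple u "2 * pi" by unfold_locales (rule u(2))
  obtain x y T where sol: "solves_system x y" and "T > 0"
    and per: "periodic_fun_simple (\<lambda>t. (x t, y t)) T"
    and nonconst: "\<not> (\<lambda>t. (x t, y t)) constant_on UNIV"
    and \<Gamma>: "\<Gamma> = range (\<lambda>t. (x t, y t))"
    using assms(2) unfolding nonconst_periodic_orbit_def nonconst_periodic_def by blast
  interpret xy: periodic_fun_simple "\<lambda>t. (x t, y t)" T by (rule per)
  define y' where "y' t = - ((x t)\<^sup>2 + (x t + y t)\<^sup>2 - 1) * y t - x t" for t
  have x: "(x has_real_derivative y t) (at t)" and y: "(y has_real_derivative y' t) (at t)" for t
    using sol by (auto simp: solves_system_def y'_def)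
  have cont: "continuous_on UNIV x" "continuous_on UNIV y"
    using DERIV_isCont[OF x] DERIV_isCont[OF y] by (auto simp: continuous_on_eq_continuous_at)
  have "continuous_on UNIV y'"
    unfolding y'_def by (intro continuous_intros cont)
  moreover have nz: "(x t)\<^sup>2 + (y t)\<^sup>2 \<noteq> 0" for t
  proof
    assume "(x t)\<^sup>2 + (y t)\<^sup>2 = 0"
    from solves_system_stays_zero[OF sol this] have "x s = 0 \<and> y s = 0" for s
      by (simp add: sum_power2_eq_zero_iff)
    then show False using nonconst by (auto simp: constant_on_def)
  qed
  ultimately obtain w \<theta> where xw: "\<And>t. x t = exp (w t) * cos (\<theta> t)"
    and yw: "\<And>t. y t = exp (w t) * sin (\<theta> t)"
    and w: "\<And>t. (w has_real_derivative (x t * y t + y t * y' t) / ((x t)\<^sup>2 + (y t)\<^sup>2)) (at t)"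
    and \<theta>: "\<And>t. (\<theta> has_real_derivative (x t * y' t - y t * y t) / ((x t)\<^sup>2 + (y t)\<^sup>2)) (at t)"
    using polar_lift[OF x y cont(2)] by metis
  let ?D = "\<lambda>t. damping (\<theta> t) (2 * w t)"
  let ?A = "\<lambda>t. angular_speed (\<theta> t) (2 * w t)"
  let ?A' = "\<lambda>t. angular_speed (\<theta> t) (u (\<theta> t))"
  have y'_D: "y' t = - ?D t * y t - x t" for t
    unfolding y'_def xw yw damping_cartesian by simp
  have r: "(x t)\<^sup>2 + (y t)\<^sup>2 = (exp (w t))\<^sup>2" for t
    unfolding xw yw power_mult_distrib distrib_left[symmetric] by simp
  have w': "(w has_real_derivative - (sin (\<theta> t))\<^sup>2 * ?D t) (at t)" for t
  proof -
    have "x t * y t + y t * y' t = - (sin (\<theta> t))\<^sup>2 * ?D t * (exp (w t))\<^sup>2"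
      unfolding y'_D by (simp add: yw power2_eq_square algebra_simps)
    then show ?thesis using w[of t] unfolding r by simp
  qed
  have \<theta>': "(\<theta> has_real_derivative - ?A t) (at t)" for t
  proof -
    have "x t * y' t - y t * y t = - ((x t)\<^sup>2 + (y t)\<^sup>2) - x t * y t * ?D t"
      unfolding y'_D by (simp add: power2_eq_square algebra_simps)
    also have "\<dots> = - ?A t * (exp (w t))\<^sup>2"
      unfolding r by (simp add: xw yw angular_speed_def power2_eq_square algebra_simps)
    finally show ?thesis using \<theta>[of t] unfolding r by simp
  qed
  have A': "1 / 8 \<le> ?A' t" for t
    using angular_speed_ge exp_bounds(2)[OF u(3)] by blast
  define V where "V t = 2 * w t - u (\<theta> t)" for t
  define V' where "V' t = 2 * (sin (\<theta> t))\<^sup>2 * (quad (\<theta> t) * (exp (u (\<theta> t)) - exp (2 * w t))) / ?A' t" for t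
  have V: "(V has_real_derivative V' t) (at t)" for t
  proof -
    have "(V has_real_derivative 2 * (- (sin (\<theta> t))\<^sup>2 * ?D t) - radial_slope (\<theta> t) (u (\<theta> t)) * - ?A t) (at t)"
      unfolding V_def by (intro DERIV_diff DERIV_cmult w' DERIV_chain2[OF u(1) \<theta>'])
    also have "2 * (- (sin (\<theta> t))\<^sup>2 * ?D t) - radial_slope (\<theta> t) (u (\<theta> t)) * - ?A t
        = 2 * (sin (\<theta> t))\<^sup>2 * (damping (\<theta> t) (u (\<theta> t)) * ?A t - ?D t * ?A' t) / ?A' t"
      using A'[of t] by (simp add: radial_slope_def field_simps)
    also have "damping (\<theta> t) (u (\<theta> t)) * ?A t - ?D t * ?A' t
        = quad (\<theta> t) * (exp (u (\<theta> t)) - exp (2 * w t))"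
      by (simp add: angular_speed_def damping_def algebra_simps)
    finally show ?thesis by (simp only: V'_def)
  qed
  have VV: "V t * V' t \<le> 0" for t
  proof -
    have "V t * (exp (u (\<theta> t)) - exp (2 * w t)) \<le> 0"
      by (auto simp: V_def mult_le_0_iff)
    moreover have "0 \<le> 2 * (sin (\<theta> t))\<^sup>2 * quad (\<theta> t) / ?A' t"
      using A'[of t] quad_bounds(1)[of "\<theta> t"] by (intro divide_nonneg_nonneg mult_nonneg_nonneg) auto
    ultimately have "2 * (sin (\<theta> t))\<^sup>2 * quad (\<theta> t) / ?A' t * (V t * (exp (u (\<theta> t)) - exp (2 * w t))) \<le> 0"
      by (rule mult_nonneg_nonpos[rotated])
    then show ?thesis by (simp add: V'_def mult_ac)
  qed
  have V2: "((\<lambda>t. (V t)\<^sup>2) has_real_derivative 2 * (V t * V' t)) (at t)" for t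
    by (auto intro!: derivative_eq_intros V)
  have decr: "(V t)\<^sup>2 \<le> (V s)\<^sup>2" if "s \<le> t" for s t
    by (rule DERIV_nonpos_imp_nonincreasing[OF that]) (metis V2 VV mult_nonneg_nonpos zero_le_numeral)
  \<comment> \<open>The lifted angle is periodic only modulo 2 pi, which suffices because u has
    period 2 pi.\<close>
  have V_per: "V (t + of_nat n * T) = V t" for t n
  proof -
    define t' where "t' = t + of_nat n * T"
    have eq: "x t' = x t" "y t' = y t" using xy.plus_of_nat[of t n] by (auto simp: t'_def)
    have "exp (2 * w t') = exp (2 * w t)"
      unfolding exp_double using r[of t'] r[of t] eq by simp
    then have "w t' = w t" by simp
    moreover from this eq have "sin (\<theta> t') = sin (\<theta> t) \<and> cos (\<theta> t') = cos (\<theta> t)"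
      by (simp add: xw yw)
    then obtain k :: int where "\<theta> t' = \<theta> t + 2 * pi * of_int k"
      using sin_cos_eq_iff by metis
    then have "u (\<theta> t') = u (\<theta> t)" using u.plus_of_int[of "\<theta> t" k] by (simp add: mult_ac)
    ultimately show ?thesis by (simp add: V_def t'_def)
  qed
  have V2_const: "(V t)\<^sup>2 = (V s)\<^sup>2" if "s \<le> t" for s t
  proof -
    obtain n where "t - s < of_nat n * T" using reals_Archimedean3[OF \<open>T > 0\<close>] by blast
    then have "(V (s + of_nat n * T))\<^sup>2 \<le> (V t)\<^sup>2" by (intro decr) simp
    then show ?thesis using decr[OF that] by (simp add: V_per)
  qed
  have V0: "V t = 0" for t
  proof (rule ccontr)
    assume "V t \<noteq> 0"
    have const: "(V s)\<^sup>2 = (V t)\<^sup>2" for s using V2_const[of s t] V2_const[of t s] by linarith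
    have square_eq: "(\<lambda>s. (V s)\<^sup>2) = (\<lambda>_. (V t)\<^sup>2)" by (intro ext const)
    \<comment> \<open>V^2 is nonincreasing and periodic, hence constant. If V is nonzero, its
      derivative can vanish only through the sine, and it does so at every time; the orbit would
      then stay on the x-axis, where y' = - x forces it into the origin.\<close>
    have "sin (\<theta> s) = 0" for s
    proof -
      have "((\<lambda>s. (V s)\<^sup>2) has_real_derivative 0) (at s)"
        by (subst square_eq) (rule DERIV_const)
      from DERIV_unique[OF V2 this] have "V s * V' s = 0" by simp
      moreover have "V s \<noteq> 0" using const[of s] \<open>V t \<noteq> 0\<close> by auto
      ultimately show ?thesis
        using A'[of s] quad_bounds(1)[of "\<theta> s"] by (auto simp: V'_def V_def)
    qed
    then have "y = (\<lambda>_. 0)" by (auto simp: yw)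
    then have "y' t = 0" "y t = 0" using DERIV_unique[OF y[of t], of 0] by auto
    then show False using nz[of t] by (simp add: y'_def)
  qed
  then have w_eq: "2 * w t = u (\<theta> t)" for t
    by (simp add: V_def)
  have curve: "(x t, y t) = polar_curve u (\<theta> t)" for t
    using w_eq[of t] by (simp add: polar_curve_def xw yw field_simps)
  \<comment> \<open>So far the orbit is only contained in the curve. Now that it has the speed of
    the cycle, at least 1/8, its angle runs through all real values and covers the curve
    completely.\<close>
  have "surj (\<lambda>t. - \<theta> t)"
    by (rule surj_if_deriv_ge[where \<delta> = "1 / 8" and f' = ?A])
      (use \<theta>' A' in \<open>auto simp: w_eq intro!: derivative_eq_intros\<close>)
  have "\<exists>t. s = \<theta> t" for s
    using surjD[OF \<open>surj (\<lambda>t. - \<theta> t)\<close>, of "- s"] by auto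
  then have "range \<theta> = UNIV" unfolding surj_def by blast
  then have "range (polar_curve u) = range (\<lambda>t. polar_curve u (\<theta> t))"
    using image_image[of "polar_curve u" \<theta> UNIV] by simp
  then show ?thesis by (simp add: \<Gamma> curve)
qed

section \<open>Back to the second-order equation\<close>

lemma solves_system_imp_solves_ode2:
  assumes "solves_system x y"
  shows "solves_ode2 x" and "deriv x = y"
proof -
  have x: "(x has_real_derivative y t) (at t)"
    and y: "(y has_real_derivative - ((x t)\<^sup>2 + (x t + y t)\<^sup>2 - 1) * y t - x t) (at t)" for t
    using assms by (auto simp: solves_system_def)
  show d: "deriv x = y" using DERIV_imp_deriv[OF x] by auto
  show "solves_ode2 x"
    unfolding solves_ode2_def d DERIV_imp_deriv[OF y]
    using x y unfolding real_differentiable_def by (intro conjI allI) (blast, blast, simp add: algebra_simps)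
qed

theorem mainTheorem3:
  shows "(\<exists>u. solves_ode2 u \<and> nonconst_periodic u) \<and>
         (\<exists>!\<Gamma>. nonconst_periodic_orbit \<Gamma>)"
proof -
  obtain u where u: "polar_cycle u" using polar_cycle_exists by blast
  then obtain x y where sol: "solves_system x y" and per: "nonconst_periodic (\<lambda>t. (x t, y t))"
    by (rule polar_cycle_solution)
  note ode = solves_system_imp_solves_ode2[OF sol]
  have "nonconst_periodic_orbit (range (\<lambda>t. (x t, y t)))"
    unfolding nonconst_periodic_orbit_def using sol per by blast
  then have orbit: "\<exists>!\<Gamma>. nonconst_periodic_orbit \<Gamma>"
    using nonconst_periodic_orbit_unique[OF u] by blast
  obtain T where "T > 0" and T: "periodic_fun_simple (\<lambda>t. (x t, y t)) T"
    and nc: "\<not> (\<lambda>t. (x t, y t)) constant_on UNIV"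
    using per by (auto simp: nonconst_periodic_def)
  have "periodic_fun_simple x T"
    using T by (auto simp: periodic_fun_simple_def)
  \<comment> \<open>Since y is the derivative of x, a constant x would make the pair
    constant.\<close>
  moreover have "\<not> x constant_on UNIV"
  proof
    assume "x constant_on UNIV"
    then obtain a where a: "x = (\<lambda>_. a)" by (auto simp: constant_on_def fun_eq_iff)
    then have "y = (\<lambda>_. 0)" using ode(2) by auto
    with a nc show False by (auto simp: constant_on_def)
  qed
  ultimately show ?thesis
    using ode(1) orbit \<open>T > 0\<close> by (auto simp: nonconst_periodic_def)
qed

end
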